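(* Let $\lambda=(\lambda_n)$ be a $\mathbf{Q}$-linearly independent frequency and let $D=\sum a_n e^{-\lambda_n s}\in\mathcal{D}_\infty^{ext}(\lambda)$. Then $(a_n)\in\ell_1$ and $\|(a_n)\|_1=\|D\|_\infty$. Moreover, isometrically (via $\sum a_n e^{-\lambda_n s}\mapsto (a_n)$) $$\mathcal{D}_\infty^{ext}(\lambda)=\mathcal{D}_\infty(\lambda)=\ell_1,$$ and $\lambda$ satisfies Bohr's theorem. In particular, $$\sup_{N\in\mathbf{N}}\ \sup_{[Re>0]}\left|\sum_{n=1}^{N} a_n e^{-\lambda_n s}\right|=\|D\|_\infty.$$
   Context: A frequency is a strictly increasing sequence $\lambda=(\lambda_n)_{n\in\mathbf{N}}$ of non-negative real numbers tending to $+\infty$ ($\mathbf{N}=\{1,2,\dots\}$). It is $\mathbf{Q}$-linearly independent if $\sum q_n\lambda_n=0$ implies $q=0$ for all finite rational sequences $q=(q_n)$. A $\lambda$-Dirichlet series is a formal sum $D=\sum_{n\ge 1} a_n e^{-\lambda_n s}$ with complex coefficients $a_n$ and complex variable $s$. $[Re>\sigma]=\{s\in\mathbf{C}: \mathrm{Re}\,s>\sigma\}$. If $D$ converges at some point, it converges on some half-plane $[Re>\sigma]$ to a holomorphic function. $\mathcal{D}_\infty^{ext}(\lambda)$ is the space of all $\lambda$-Dirichlet series $D$ which converge at some point of $\mathbf{C}$ and whose limit function has a (unique) holomorphic and bounded extension $f$ to $[Re>0]$; $\|D\|_\infty:=\sup_{[Re>0]}|f(s)|$. $\mathcal{D}_\infty(\lambda)$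 is the subspace of all $\lambda$-Dirichlet series which converge on $[Re>0]$ and define a bounded function there. $\lambda$ satisfies Bohr's theorem if every $D\in\mathcal{D}_\infty^{ext}(\lambda)$ converges uniformly on $[Re>\varepsilon]$ for all $\varepsilon>0$. $\ell_1$ is the Banach space of absolutely summable complex sequences with norm $\|(a_n)\|_1=\sum|a_n|$. *)

theory Defs
  imports "HOL-Complex_Analysis.Complex_Analysis"
begin

text \<open>Sequences are indexed from 0: \<open>lam n\<close> and \<open>a n\<close> stand for \<open>\<lambda>\<^sub>n\<^sub>+\<^sub>1\<close> and \<open>a\<^sub>n\<^sub>+\<^sub>1\<close>.
  A formal \<open>\<lambda>\<close>-Dirichlet series is represented by its coefficient sequence, so spaces of such
  series are sets of sequences and the map sending a series to its coefficients is the identity.\<close>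

definition frequency :: "(nat \<Rightarrow> real) \<Rightarrow> bool" where
  "frequency lam \<longleftrightarrow> strict_mono lam \<and> (\<forall>n. 0 \<le> lam n) \<and> filterlim lam at_top sequentially"

definition rat_independent :: "(nat \<Rightarrow> real) \<Rightarrow> bool" where
  "rat_independent lam \<longleftrightarrow>
     (\<forall>N (q :: nat \<Rightarrow> rat). (\<Sum>n<N. of_rat (q n) * lam n) = 0 \<longrightarrow> (\<forall>n<N. q n = 0))"

definition half_plane :: "real \<Rightarrow> complex set" where
  "half_plane \<sigma> = {s. \<sigma> < Re s}"

definition dir_term :: "(nat \<Rightarrow> real) \<Rightarrow> (nat \<Rightarrow> complex) \<Rightarrow> complex \<Rightarrow> nat \<Rightarrow> complex" where
  "dir_term lam a s n = a n * exp (- of_real (lam n) * s)"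

definition dir_partial :: "(nat \<Rightarrow> real) \<Rightarrow> (nat \<Rightarrow> complex) \<Rightarrow> nat \<Rightarrow> complex \<Rightarrow> complex" where
  "dir_partial lam a N s = (\<Sum>n<N. dir_term lam a s n)"

text \<open>Agreement with the limit function is required on some half-plane of convergence contained in
  \<open>[Re > 0]\<close>; by the identity theorem the choice of the half-plane is immaterial.\<close>

definition bounded_extension ::
    "(nat \<Rightarrow> real) \<Rightarrow> (nat \<Rightarrow> complex) \<Rightarrow> (complex \<Rightarrow> complex) \<Rightarrow> bool" where
  "bounded_extension lam a f \<longleftrightarrow>
     f holomorphic_on half_plane 0 \<and> bounded (f ` half_plane 0) \<and>
     (\<exists>\<sigma>\<ge>0. \<forall>s\<in>half_plane \<sigma>. dir_term lam a s sums f s)"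

definition D_ext :: "(nat \<Rightarrow> real) \<Rightarrow> (nat \<Rightarrow> complex) set" where
  "D_ext lam = {a. (\<exists>s. summable (dir_term lam a s)) \<and> (\<exists>f. bounded_extension lam a f)}"

text \<open>The extension is unique on \<open>[Re > 0]\<close> only (a HOL function also has values elsewhere), hence
  the choice operator; see \<open>D_norm_eq\<close> below for independence of the choice.\<close>

definition D_norm :: "(nat \<Rightarrow> real) \<Rightarrow> (nat \<Rightarrow> complex) \<Rightarrow> real" where
  "D_norm lam a = (SUP s\<in>half_plane 0. norm ((SOME f. bounded_extension lam a f) s))"

definition D_inf :: "(nat \<Rightarrow> real) \<Rightarrow> (nat \<Rightarrow> complex) set" where
  "D_inf lam = {a. (\<forall>s\<in>half_plane 0. summable (dir_term lam a s)) \<and>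
     bounded ((\<lambda>s. \<Sum>n. dir_term lam a s n) ` half_plane 0)}"

definition bohr_theorem :: "(nat \<Rightarrow> real) \<Rightarrow> bool" where
  "bohr_theorem lam \<longleftrightarrow>
     (\<forall>a\<in>D_ext lam. \<forall>\<epsilon>>0. uniformly_convergent_on (half_plane \<epsilon>) (dir_partial lam a))"

definition ell1 :: "(nat \<Rightarrow> complex) set" where
  "ell1 = {a. summable (\<lambda>n. norm (a n))}"

definition ell1_norm :: "(nat \<Rightarrow> complex) \<Rightarrow> real" where
  "ell1_norm a = (\<Sum>n. norm (a n))"

lemma bounded_extension_unique:
  assumes f: "bounded_extension lam a f" and g: "bounded_extension lam a g"
    and s: "s \<in> half_plane 0"
  shows "f s = g s"
proof -
  obtain \<sigma> \<tau> where \<sigma>: "\<sigma> \<ge> 0" "\<And>s. s \<in> half_plane \<sigma> \<Longrightarrow> dir_term lam a s sums f s"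
    and \<tau>: "\<tau> \<ge> 0" "\<And>s. s \<in> half_plane \<tau> \<Longrightarrow> dir_term lam a s sums g s"
    using f g unfolding bounded_extension_def by blast
  define T where "T = half_plane (max \<sigma> \<tau>)"
  have eq: "f z = g z" if "z \<in> T" for z
    using that \<sigma>(2)[of z] \<tau>(2)[of z] sums_unique2 by (auto simp: T_def half_plane_def)
  have "of_real (max \<sigma> \<tau> + 1) \<in> T" by (auto simp: T_def half_plane_def max_def)
  then have ne: "T \<noteq> {}" by blast
  have T: "open T" "T \<subseteq> half_plane 0"
    using \<sigma>(1) open_halfspace_Re_gt[of "max \<sigma> \<tau>"] unfolding T_def half_plane_def by (blast, auto)
  have op: "open (half_plane 0)" by (simp add: half_plane_def open_halfspace_Re_gt)
  have con: "connected (half_plane 0)"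
    unfolding half_plane_def by (intro convex_connected convex_halfspace_Re_gt)
  show ?thesis
    by (rule analytic_continuation_open[OF T(1) op ne con T(2)])
       (use f g eq s in \<open>auto simp: bounded_extension_def\<close>)
qed

lemma D_norm_eq:
  assumes "bounded_extension lam a f"
  shows "D_norm lam a = (SUP s\<in>half_plane 0. norm (f s))"
proof -
  have "bounded_extension lam a (SOME f. bounded_extension lam a f)"
    using assms by (rule someI[of "bounded_extension lam a"])
  then show ?thesis
    unfolding D_norm_def using bounded_extension_unique[OF _ assms] by (intro SUP_cong) auto
qed

end

theory Submission
  imports Defs "HOL-Probability.Sinc_Integral"
begin

text \<open>By Kronecker's theorem, the supremum over real \<open>t\<close> of
  \<open>\<bar>\<Sum> b\<^sub>n exp (- i \<lambda>\<^sub>n t)\<bar>\<close> is \<open>\<Sum> \<bar>b\<^sub>n\<bar>\<close> for \<open>\<rat>\<close>-independent frequencies and absolutely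
  summable \<open>b\<close>. Convergence need not be absolute anywhere a priori, so the limit function is first
  convolved, on a vertical line to the right of the abscissa of convergence, with a nonnegative kernel
  whose Fourier transform has compact support: this leaves a Dirichlet polynomial with the same bound,
  and letting the support grow gives absolute convergence on that line. The kernel must decay
  faster than \<open>1/u\<^sup>2\<close>, because partial sums grow linearly in the imaginary part. Absolute convergence is
  then pushed to the left by Landau's argument: Kronecker's theorem turns the Cauchy
  estimates at a point \<open>c\<close> into estimates for \<open>\<Sum> \<bar>a\<^sub>n\<bar> \<lambda>\<^sub>n\<^sup>k exp (- c \<lambda>\<^sub>n)\<close>, and the Taylor expansion with nonnegative
  terms converges up to the imaginary axis.\<close>

section \<open>Kronecker's theorem for coefficient sums\<close>

text \<open>Shifting the origin to \<open>s\<close> turns the terms at \<open>s\<close> into the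
  coefficients of another series with the same frequency. This reduces estimates on a vertical line
  to the imaginary axis.\<close>

lemma dir_term_add: "dir_term lam a (s + z) n = dir_term lam (dir_term lam a s) z n"
  by (simp add: dir_term_def right_diff_distrib distrib_left mult.assoc flip: exp_add)

lemma norm_dir_term: "norm (dir_term lam a s n) = norm (a n) * exp (- lam n * Re s)"
  by (simp add: dir_term_def norm_mult)

lemma rat_independent_inj:
  assumes "rat_independent lam"
  shows "inj lam"
proof (rule injI, rule ccontr)
  fix i j :: nat assume eq: "lam i = lam j" and ne: "i \<noteq> j"
  define q :: "nat \<Rightarrow> rat" where "q n = (if n = i then 1 else 0) + (if n = j then -1 else 0)" for n
  have "(\<Sum>n<Suc (max i j). of_rat (q n) * lam n)
      = (\<Sum>n<Suc (max i j). (if n = i then lam n else 0) + (if n = j then - lam n else 0))"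
    by (intro sum.cong) (auto simp: q_def ne)
  also have "\<dots> = lam i - lam j"
    unfolding sum.distrib by (subst (1 2) sum.delta) auto
  finally have "q i = 0"
    using assms[unfolded rat_independent_def, rule_format, of q "Suc (max i j)" i] eq by simp
  then show False by (simp add: q_def ne)
qed

text \<open>Kronecker's theorem takes independence of a set over the integers. A relation between
  the values pulls back along the injective \<open>lam\<close> to a rational relation between
  indices.\<close>

lemma rat_independent_int:
  assumes "rat_independent lam"
  shows "module.independent (\<lambda>r. (*) (real_of_int r)) (lam ` {..<N})"
proof -
  interpret Modules.module "\<lambda>r. (*) (real_of_int r)"
    by (simp add: Modules.module.intro distrib_left mult.commute)
  have inj: "inj_on lam {..<N}"
    using rat_independent_inj[OF assms] by (rule inj_on_subset) auto
  show ?thesis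
  proof
    assume "dependent (lam ` {..<N})"
    then obtain u where u: "\<exists>v\<in>lam ` {..<N}. u v \<noteq> 0" "(\<Sum>v\<in>lam ` {..<N}. real_of_int (u v) * v) = 0"
      by (subst (asm) dependent_finite) auto
    then have "(\<Sum>n<N. of_rat (of_int (u (lam n))) * lam n) = 0"
      by (simp add: sum.reindex[OF inj])
    from assms[unfolded rat_independent_def, rule_format, OF this] u(1) show False by auto
  qed
qed

lemma norm_iexp_minus_1: "norm (exp (\<i> * of_real x) - 1) \<le> \<bar>x\<bar>" for x :: real
  using abs_sin_x_le_abs_x[of "x / 2"] by (simp add: dist_exp_i_1)

text \<open>Some real \<open>t\<close> rotates the first \<open>N\<close> terms simultaneously
  almost onto the nonnegative real axis. There the partial sum almost equals the sum of the norms,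
  while \<open>B\<close> does not depend on \<open>t\<close>.\<close>

lemma kronecker_sum_norm_le:
  assumes ind: "rat_independent lam"
    and bnd: "\<And>t. norm (dir_partial lam b N (\<i> * of_real t)) \<le> B"
  shows "(\<Sum>n<N. norm (b n)) \<le> B"
proof -
  define S where "S = (\<Sum>n<N. norm (b n))"
  have S: "S \<ge> 0" by (auto simp: S_def intro: sum_nonneg)
  have le: "S \<le> B + 2 * pi * S * \<delta>" if \<delta>: "\<delta> > 0" for \<delta> :: real
  proof -
    obtain t h where th: "\<And>n. n < N \<Longrightarrow> \<bar>t * lam n - of_int (h n) - Arg (b n) / (2 * pi)\<bar> < \<delta>"
      by (rule Kronecker_thm_1[OF rat_independent_int[OF ind]
          inj_on_subset[OF rat_independent_inj[OF ind] subset_UNIV] \<delta>, of N "\<lambda>n. Arg (b n) / (2 * pi)"]) (erule that)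
    \<comment> \<open>Phase errors measured in full turns; evaluating at 2 pi t turns approximation
      modulo 1 into approximation modulo 2 pi.\<close>
    define e where "e n = t * lam n - of_int (h n) - Arg (b n) / (2 * pi)" for n
    let ?z = "\<i> * of_real (2 * pi * t)"
    have tm: "dir_term lam b ?z n = of_real (norm (b n)) * exp (\<i> * of_real (- 2 * pi * e n))" for n
    proof -
      have "b n = of_real (norm (b n)) * exp (\<i> * of_real (Arg (b n)))"
        using Arg_eq[of "b n"] by (cases "b n = 0") auto
      then have "dir_term lam b ?z n = of_real (norm (b n)) *
          (exp (\<i> * of_real (Arg (b n))) * exp (- of_real (lam n) * ?z))"
        unfolding dir_term_def by (metis mult.assoc)
      also have "exp (\<i> * of_real (Arg (b n))) * exp (- of_real (lam n) * ?z)
          = exp (\<i> * of_real (- 2 * pi * e n) + 2 * of_int (- h n) * of_real pi * \<i>)"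
        unfolding exp_add[symmetric] by (rule arg_cong[of _ _ exp]) (simp add: e_def field_simps)
      also have "\<dots> = exp (\<i> * of_real (- 2 * pi * e n))"
        unfolding exp_eq by (rule exI[of _ "- h n"]) simp
      finally show ?thesis .
    qed
    have "norm (of_real S - dir_partial lam b N ?z)
        = norm (\<Sum>n<N. of_real (norm (b n)) * (1 - exp (\<i> * of_real (- 2 * pi * e n))))"
      unfolding dir_partial_def S_def tm by (simp add: sum_subtractf right_diff_distrib)
    also have "\<dots> \<le> (\<Sum>n<N. norm (b n) * (2 * pi * \<delta>))"
    proof (rule sum_norm_le)
      fix n assume "n \<in> {..<N}"
      then have "\<bar>e n\<bar> < \<delta>" using th by (auto simp: e_def)
      then have "\<bar>- 2 * pi * e n\<bar> \<le> 2 * pi * \<delta>" by (simp add: abs_mult)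
      then have "norm (1 - exp (\<i> * of_real (- 2 * pi * e n))) \<le> 2 * pi * \<delta>"
        using norm_iexp_minus_1[of "- 2 * pi * e n"] by (subst norm_minus_commute) linarith
      then show "norm (of_real (norm (b n)) * (1 - exp (\<i> * of_real (- 2 * pi * e n))))
          \<le> norm (b n) * (2 * pi * \<delta>)"
        by (simp add: norm_mult mult_left_mono)
    qed
    also have "\<dots> = 2 * pi * S * \<delta>"
      by (simp add: S_def sum_distrib_right[symmetric])
    finally have "norm (of_real S - dir_partial lam b N ?z) \<le> 2 * pi * S * \<delta>" .
    moreover have "norm (complex_of_real S) \<le> norm (dir_partial lam b N ?z) + norm (of_real S - dir_partial lam b N ?z)"
      by (metis norm_triangle_sub)
    ultimately show ?thesis using bnd[of "2 * pi * t"] S by simp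
  qed
  have "((\<lambda>\<delta>. B + 2 * pi * S * \<delta>) \<longlongrightarrow> B + 2 * pi * S * 0) (at_right 0)"
    by (intro tendsto_intros)
  then have "S \<le> B + 2 * pi * S * 0"
    by (rule tendsto_lowerbound) (auto intro!: eventually_at_rightI[of 0 1] le)
  then show ?thesis by (simp add: S_def)
qed

text \<open>Each partial sum differs from the full sum by at most the tail of the norms. So the
  finite case applies with \<open>B\<close> enlarged by a tail that tends to 0.\<close>

lemma kronecker_suminf_norm_le:
  assumes ind: "rat_independent lam" and sm: "summable (\<lambda>n. norm (b n))"
    and bnd: "\<And>t. norm (\<Sum>n. dir_term lam b (\<i> * of_real t) n) \<le> B"
  shows "(\<Sum>n. norm (b n)) \<le> B"
proof -
  let ?S = "\<Sum>n. norm (b n)"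
  have le: "(\<Sum>n<N. norm (b n)) \<le> B + (?S - (\<Sum>n<N. norm (b n)))" for N
  proof (rule kronecker_sum_norm_le[OF ind])
    fix t :: real
    let ?f = "dir_term lam b (\<i> * of_real t)"
    have nf: "(\<lambda>n. norm (?f n)) = (\<lambda>n. norm (b n))" by (simp add: norm_dir_term)
    have sf: "summable (\<lambda>n. norm (?f n))" using sm by (simp add: nf)
    have "norm (suminf ?f - (\<Sum>n<N. ?f n)) = norm (\<Sum>n. ?f (n + N))"
      using suminf_minus_initial_segment[OF summable_norm_cancel[OF sf], of N] by simp
    also have "\<dots> \<le> (\<Sum>n. norm (?f (n + N)))"
      by (rule summable_norm) (rule summable_ignore_initial_segment[OF sf])
    also have "\<dots> = ?S - (\<Sum>n<N. norm (b n))"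
      using suminf_minus_initial_segment[OF sf, of N] by (simp add: norm_dir_term)
    finally have "norm (suminf ?f - dir_partial lam b N (\<i> * of_real t)) \<le> ?S - (\<Sum>n<N. norm (b n))"
      by (simp add: dir_partial_def)
    then show "norm (dir_partial lam b N (\<i> * of_real t)) \<le> B + (?S - (\<Sum>n<N. norm (b n)))"
      using bnd[of t] norm_triangle_sub[of "dir_partial lam b N (\<i> * of_real t)" "suminf ?f"]
      by (simp add: norm_minus_commute)
  qed
  have lim: "(\<lambda>N. \<Sum>n<N. norm (b n)) \<longlonglongrightarrow> ?S" using sm by (rule summable_LIMSEQ)
  then have "(\<lambda>N. B + (?S - (\<Sum>n<N. norm (b n)))) \<longlonglongrightarrow> B + (?S - ?S)"
    by (intro tendsto_intros)
  from LIMSEQ_le[OF lim this] le show ?thesis by auto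
qed

section \<open>Abel summation\<close>

text \<open>Mean value inequality: \<open>\<phi>\<close> is a primitive of the norm of the
  derivative of exp(-xz) with respect to the real variable x.\<close>

lemma norm_exp_diff_le:
  assumes z: "0 < Re z" and ab: "a \<le> b"
  shows "norm (exp (- of_real a * z) - exp (- of_real b * z))
     \<le> norm z / Re z * (exp (- a * Re z) - exp (- b * Re z))"
proof (cases "a = b")
  case False
  define \<phi> where "\<phi> x = - norm z / Re z * exp (- x * Re z)" for x :: real
  have "norm (exp (- of_real b * z) - exp (- of_real a * z)) \<le> \<phi> b - \<phi> a"
  proof (rule differentiable_bound_general)
    show "a < b" using ab False by simp
    show "((\<lambda>x. exp (- of_real x * z)) has_vector_derivative - z * exp (- of_real x * z)) (at x)" for x
      by (rule has_vector_derivative_real_field[where f = "\<lambda>x. exp (- x * z)"])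
         (auto intro!: derivative_eq_intros)
    show "(\<phi> has_vector_derivative norm z * exp (- x * Re z)) (at x)" for x
      unfolding \<phi>_def has_real_derivative_iff_has_vector_derivative[symmetric]
      by (auto intro!: derivative_eq_intros simp: z less_imp_neq[OF z, symmetric])
    show "norm (- z * exp (- of_real x * z)) \<le> norm z * exp (- x * Re z)" for x
      by (simp add: norm_mult)
  qed (use z in \<open>auto simp: \<phi>_def intro!: continuous_intros\<close>)
  then show ?thesis
    by (subst norm_minus_commute) (simp add: \<phi>_def algebra_simps)
qed simp

lemma abel_partial_sum:
  fixes b e :: "nat \<Rightarrow> complex"
  shows "(\<Sum>n<Suc N. b n * e n) = (\<Sum>n<Suc N. b n) * e N + (\<Sum>n<N. (\<Sum>k<Suc n. b k) * (e n - e (Suc n)))"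
  by (induction N) (simp_all add: algebra_simps)

text \<open>Summation by parts: the increments of the exponentials are dominated by a telescoping
  sum, at the price of the factor \<open>norm z / Re z\<close>. Along a vertical line this factor
  grows linearly.\<close>

lemma dir_partial_abel_bound:
  assumes mono: "mono lam" and pos: "\<And>n. 0 \<le> lam n"
    and B: "\<And>k. norm (\<Sum>n<k. b n) \<le> B" and z: "0 < Re z"
  shows "norm (dir_partial lam b N z) \<le> B * (1 + norm z / Re z)"
proof (cases N)
  case 0
  then show ?thesis using B[of 0] z by (simp add: dir_partial_def)
next
  case (Suc K)
  let ?e = "\<lambda>n. exp (- of_real (lam n) * z)" and ?r = "\<lambda>n. exp (- lam n * Re z)"
  have B0: "B \<ge> 0" using B[of 0] by simp
  have "norm (dir_partial lam b N z) \<le> norm ((\<Sum>n<Suc K. b n) * ?e K)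
      + norm (\<Sum>n<K. (\<Sum>k<Suc n. b k) * (?e n - ?e (Suc n)))"
    unfolding dir_partial_def dir_term_def Suc abel_partial_sum by (rule norm_triangle_ineq)
  also have "norm ((\<Sum>n<Suc K. b n) * ?e K) \<le> B * 1"
    unfolding norm_mult by (intro mult_mono B B0) (use pos[of K] z in auto)
  also have "norm (\<Sum>n<K. (\<Sum>k<Suc n. b k) * (?e n - ?e (Suc n)))
      \<le> (\<Sum>n<K. B * (norm z / Re z * (?r n - ?r (Suc n))))"
  proof (rule sum_norm_le)
    fix n
    have "norm (?e n - ?e (Suc n)) \<le> norm z / Re z * (?r n - ?r (Suc n))"
      by (rule norm_exp_diff_le[OF z]) (use mono in \<open>simp add: monoD\<close>)
    then show "norm ((\<Sum>k<Suc n. b k) * (?e n - ?e (Suc n))) \<le> B * (norm z / Re z * (?r n - ?r (Suc n)))"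
      unfolding norm_mult by (intro mult_mono B B0) auto
  qed
  also have "\<dots> = B * (norm z / Re z * (?r 0 - ?r K))"
    unfolding sum_distrib_left[symmetric] by (subst sum_lessThan_telescope') simp
  also have "\<dots> \<le> B * (norm z / Re z * 1)"
  proof (intro mult_left_mono B0)
    have "?r 0 \<le> 1" "?r K \<ge> 0" using pos[of 0] z by auto
    then show "?r 0 - ?r K \<le> 1" by linarith
  qed (use z in auto)
  finally show ?thesis by (simp add: distrib_left)
qed

section \<open>A kernel with compactly supported Fourier transform\<close>

text \<open>The square of the Fejer kernel (1 - cos u)/u^2, that is, a Jackson kernel. It decays
  like u^(-4), so it stays integrable against 1 + |u|. The value 0 at \<open>u = 0\<close>, from
  division by zero, affects only a null set.\<close>

definition riesz_kernel :: "real \<Rightarrow> real" where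
  "riesz_kernel u = (1 - cos u)\<^sup>2 / u ^ 4"

text \<open>The Fourier transform of the kernel, a cosine integral because the kernel is even. It is
  not normalised: \<open>riesz_mult 0\<close> is the total mass.\<close>

definition riesz_mult :: "real \<Rightarrow> real" where
  "riesz_mult y = (LBINT u. riesz_kernel u * cos (y * u))"

lemma riesz_kernel_nonneg: "0 \<le> riesz_kernel u"
  by (simp add: riesz_kernel_def)

lemma riesz_kernel_measurable [measurable]: "riesz_kernel \<in> borel_measurable borel"
  unfolding riesz_kernel_def[abs_def] by measurable

lemma one_minus_cos_le: "1 - cos x \<le> x\<^sup>2 / 2" for x :: real
proof -
  have "1 - cos x = 2 * (sin (x / 2))\<^sup>2"
    using cos_double_sin[of "x / 2"] by simp
  also have "(sin (x / 2))\<^sup>2 \<le> (x / 2)\<^sup>2"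
    using abs_sin_x_le_abs_x[of "x / 2"] by (simp only: abs_le_square_iff)
  finally show ?thesis by (simp add: power2_eq_square)
qed

lemma integrable_inverse_one_plus_square: "integrable lborel (\<lambda>u::real. C / (1 + u\<^sup>2))"
proof -
  have "integrable lborel (\<lambda>u::real. C * inverse (1 + u\<^sup>2))"
    using integrable_inverse_1_plus_square by (simp add: set_integrable_def)
  then show ?thesis by (simp add: divide_inverse)
qed

text \<open>Near 0 the quadratic bound on 1 - cos u gives a kernel of at most 1/4; elsewhere 1 - cos
  u is at most 2. The constant 16 comes from the outer range.\<close>

lemma riesz_kernel_bound: "(1 + \<bar>u\<bar>) * riesz_kernel u \<le> 16 / (1 + u\<^sup>2)"
proof (cases "\<bar>u\<bar> \<le> 1")
  case True
  then have u2: "u\<^sup>2 \<le> 1" by (simp add: abs_square_le_1)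
  have "(1 - cos u)\<^sup>2 \<le> (u\<^sup>2 / 2)\<^sup>2"
    by (rule power_mono) (use one_minus_cos_le in auto)
  then have "riesz_kernel u \<le> 1 / 4"
    by (cases "u = 0") (auto simp: riesz_kernel_def pos_divide_le_eq power_divide simp flip: power_mult)
  then have "(1 + \<bar>u\<bar>) * riesz_kernel u \<le> 2 * (1 / 4)"
    using True by (intro mult_mono riesz_kernel_nonneg) auto
  also have "\<dots> \<le> 16 / (1 + u\<^sup>2)" using u2 by (simp add: field_simps add_pos_nonneg)
  finally show ?thesis .
next
  case False
  then have u: "1 \<le> \<bar>u\<bar>" by simp
  then have u2: "1 \<le> u\<^sup>2" by (metis one_le_power power2_abs)
  have "(1 - cos u)\<^sup>2 \<le> 2\<^sup>2"
    using cos_ge_minus_one[of u] cos_le_one[of u] by (intro power_mono) linarith+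
  then have k: "riesz_kernel u \<le> 4 / u ^ 4"
    unfolding riesz_kernel_def by (intro divide_right_mono) auto
  have "(1 + \<bar>u\<bar>) * riesz_kernel u \<le> (2 * \<bar>u\<bar> * \<bar>u\<bar>) * (4 / u ^ 4)"
  proof (intro mult_mono k riesz_kernel_nonneg)
    show "1 + \<bar>u\<bar> \<le> 2 * \<bar>u\<bar> * \<bar>u\<bar>"
      using u mult_mono[of 1 "\<bar>u\<bar>" "\<bar>u\<bar>" "\<bar>u\<bar>"] by linarith
  qed auto
  also have "\<dots> = 8 / u\<^sup>2"
    using u by (auto simp: field_simps power2_eq_square eval_nat_numeral)
  also have "\<dots> = 16 / (2 * u\<^sup>2)" by simp
  also have "\<dots> \<le> 16 / (1 + u\<^sup>2)"
    using u u2 by (intro divide_left_mono mult_pos_pos) (auto intro: add_pos_nonneg)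
  finally show ?thesis .
qed

text \<open>The weight models the linear growth of partial sums on a vertical line, so this provides
  the majorant for dominated convergence.\<close>

lemma integrable_riesz_kernel_linear:
  assumes "0 \<le> A" "0 \<le> B"
  shows "integrable lborel (\<lambda>u. (A + B * \<bar>u\<bar>) * riesz_kernel u)"
proof (rule Bochner_Integration.integrable_bound)
  show "integrable lborel (\<lambda>u::real. ((A + B) * 16) / (1 + u\<^sup>2))"
    by (rule integrable_inverse_one_plus_square)
  have "norm ((A + B * \<bar>u\<bar>) * riesz_kernel u) \<le> norm ((A + B) * 16 / (1 + u\<^sup>2))" for u
  proof -
    have "(A + B * \<bar>u\<bar>) * riesz_kernel u \<le> ((A + B) * (1 + \<bar>u\<bar>)) * riesz_kernel u"
      using assms by (intro mult_right_mono riesz_kernel_nonneg) (simp add: algebra_simps)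
    also have "\<dots> \<le> (A + B) * (16 / (1 + u\<^sup>2))"
      unfolding mult.assoc by (intro mult_left_mono riesz_kernel_bound) (use assms in auto)
    finally show ?thesis using assms riesz_kernel_nonneg[of u] by simp
  qed
  then show "AE u in lborel. norm ((A + B * \<bar>u\<bar>) * riesz_kernel u) \<le> norm ((A + B) * 16 / (1 + u\<^sup>2))"
    by simp
qed measurable

lemma integrable_riesz_kernel: "integrable lborel riesz_kernel"
  using integrable_riesz_kernel_linear[of 1 0] by simp

lemma riesz_mult_0: "riesz_mult 0 = (LBINT u. riesz_kernel u)"
  by (simp add: riesz_mult_def)

text \<open>On [1,2] the kernel is at least \<open>c\<close>, since cos decreases there and u^4 is
  at most 16. Positivity allows the mass to be divided out at the end.\<close>

lemma riesz_mult_0_pos: "0 < riesz_mult 0"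
proof -
  define c where "c = (1 - cos 1)\<^sup>2 / (16::real)"
  have c1: "cos (1::real) < 1" using cos_monotone_0_pi[of 0 1] pi_gt3 by simp
  have "c * measure lborel {1..2::real} = (LBINT u. c * indicator {1..2::real} u)" by simp
  also have "\<dots> \<le> (LBINT u. riesz_kernel u)"
  proof (rule integral_mono)
    show "integrable lborel (\<lambda>u. c * indicator {1..2::real} u)"
      by (intro integrable_mult_right integrable_real_indicator) auto
    show "integrable lborel riesz_kernel" by (rule integrable_riesz_kernel)
    fix u :: real
    show "c * indicator {1..2::real} u \<le> riesz_kernel u"
    proof (cases "u \<in> {1..2}")
      case True
      then have "cos u \<le> cos 1" using pi_gt3 by (intro cos_monotone_0_pi_le) auto
      then have "(1 - cos 1)\<^sup>2 \<le> (1 - cos u)\<^sup>2" using c1 by (intro power_mono) auto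
      moreover have "u ^ 4 \<le> 2 ^ 4" using True by (intro power_mono) auto
      ultimately have "(1 - cos 1)\<^sup>2 / 16 \<le> (1 - cos u)\<^sup>2 / u ^ 4"
        using True by (intro frac_le) auto
      then show ?thesis using True by (simp add: c_def riesz_kernel_def)
    qed (simp add: riesz_kernel_nonneg)
  qed
  finally have "c \<le> riesz_mult 0" by (simp add: riesz_mult_0)
  moreover have "0 < c" using c1 by (simp add: c_def)
  ultimately show ?thesis by linarith
qed

text \<open>Dividing cos by u^4 is not integrable at 0. Removing the Taylor polynomial of degree 2
  repairs this and keeps integrability at infinity.\<close>

definition cos_rem :: "real \<Rightarrow> real" where
  "cos_rem x = cos x - 1 + x\<^sup>2 / 2"

lemma cos_rem_bounds:
  shows "0 \<le> cos_rem x" and "cos_rem x \<le> x ^ 4 / 24" and "cos_rem x \<le> x\<^sup>2 / 2"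
proof -
  show "0 \<le> cos_rem x" using one_minus_cos_le[of x] by (simp add: cos_rem_def)
  show "cos_rem x \<le> x\<^sup>2 / 2" by (simp add: cos_rem_def)
  obtain t where t: "cos x = (\<Sum>m<4. cos_coeff m * x ^ m) + cos (t + 1/2 * real 4 * pi) / fact 4 * x ^ 4"
    using Maclaurin_cos_expansion[of x 4] by blast
  have "(\<Sum>m<4. cos_coeff m * x ^ m) = 1 - x\<^sup>2 / 2"
    by (simp add: lessThan_nat_numeral lessThan_Suc cos_coeff_def)
  moreover have "cos (t + 1/2 * real 4 * pi) / fact 4 * x ^ 4 \<le> 1 / fact 4 * x ^ 4"
    by (intro mult_right_mono divide_right_mono) auto
  ultimately show "cos_rem x \<le> x ^ 4 / 24"
    using t by (simp add: cos_rem_def fact_numeral)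
qed

text \<open>The quartic bound on \<open>cos_rem\<close> controls the quotient near 0 and the
  quadratic bound controls it at infinity. Their combination, 1/24 + 1/2, stays below 1.\<close>

lemma integrable_cos_rem: "integrable lborel (\<lambda>u. cos_rem u / u ^ 4)"
proof (rule Bochner_Integration.integrable_bound)
  show "integrable lborel (\<lambda>u::real. 1 / (1 + u\<^sup>2))"
    by (rule integrable_inverse_one_plus_square)
  have "norm (cos_rem u / u ^ 4) \<le> norm (1 / (1 + u\<^sup>2))" for u
  proof (cases "u = 0")
    case False
    have 1: "cos_rem u / u ^ 4 \<le> 1 / 24"
      using cos_rem_bounds(2)[of u] False by (simp add: pos_divide_le_eq)
    have "cos_rem u / u ^ 4 \<le> (u\<^sup>2 / 2) / u ^ 4"
      using cos_rem_bounds(3) by (intro divide_right_mono) auto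
    also have "\<dots> = 1 / (2 * u\<^sup>2)"
      using False by (simp add: power2_eq_square eval_nat_numeral)
    finally have 2: "cos_rem u / u ^ 4 \<le> 1 / (2 * u\<^sup>2)" .
    have "cos_rem u / u ^ 4 * (1 + u\<^sup>2) = cos_rem u / u ^ 4 + cos_rem u / u ^ 4 * u\<^sup>2"
      by (simp add: distrib_left)
    also have "\<dots> \<le> 1 / 24 + 1 / (2 * u\<^sup>2) * u\<^sup>2"
      using 1 2 by (intro add_mono mult_right_mono) auto
    also have "\<dots> \<le> 1" using False by simp
    finally have "cos_rem u / u ^ 4 \<le> 1 / (1 + u\<^sup>2)"
      by (subst pos_le_divide_eq) (auto simp: add_pos_nonneg)
    then show ?thesis
      using cos_rem_bounds(1)[of u] by simp
  qed (simp add: cos_rem_def)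
  then show "AE u in lborel. norm (cos_rem u / u ^ 4) \<le> norm (1 / (1 + u\<^sup>2))" by simp
qed (unfold cos_rem_def[abs_def], measurable)

text \<open>Substituting yu for u contributes y^4 from the denominator and 1/|y| from the measure,
  hence the cube. For \<open>y = 0\<close> both sides vanish.\<close>

lemma
  shows integrable_cos_rem_scaled: "integrable lborel (\<lambda>u. cos_rem (y * u) / u ^ 4)"
    and integral_cos_rem_scaled:
      "(LBINT u. cos_rem (y * u) / u ^ 4) = \<bar>y\<bar> ^ 3 * (LBINT u. cos_rem u / u ^ 4)"
proof -
  have "integrable lborel (\<lambda>u. cos_rem (y * u) / u ^ 4) \<and>
    (LBINT u. cos_rem (y * u) / u ^ 4) = \<bar>y\<bar> ^ 3 * (LBINT u. cos_rem u / u ^ 4)"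
  proof (cases "y = 0")
    case False
    have eq: "(\<lambda>u. cos_rem (y * u) / u ^ 4) = (\<lambda>u. y ^ 4 * (cos_rem (0 + y * u) / (0 + y * u) ^ 4))"
      using False by (auto simp: power_mult_distrib fun_eq_iff)
    have "(LBINT u. cos_rem u / u ^ 4) = \<bar>y\<bar> *\<^sub>R (LBINT u. cos_rem (0 + y * u) / (0 + y * u) ^ 4)"
      by (rule lborel_integral_real_affine[OF False])
    then have "\<bar>y\<bar> ^ 3 * (LBINT u. cos_rem u / u ^ 4)
        = \<bar>y\<bar> ^ 4 * (LBINT u. cos_rem (0 + y * u) / (0 + y * u) ^ 4)"
      by (simp add: eval_nat_numeral)
    then show ?thesis
      unfolding eq using lborel_integrable_real_affine[OF integrable_cos_rem False, of 0]
      by (simp only: integral_mult_right_zero integrable_mult_right power_even_abs_numeral even_numeral)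
  qed (simp add: cos_rem_def)
  then show "integrable lborel (\<lambda>u. cos_rem (y * u) / u ^ 4)"
    "(LBINT u. cos_rem (y * u) / u ^ 4) = \<bar>y\<bar> ^ 3 * (LBINT u. cos_rem u / u ^ 4)" by auto
qed

text \<open>The product formulas turn the left side into a fourth central difference of cos, with
  weights 1, -4, 6, -4, 1. Such a difference annihilates polynomials of degree at most 3, so cos may
  be replaced by \<open>cos_rem\<close>.\<close>

lemma riesz_kernel_cos:
  "riesz_kernel u * cos (y * u) = (cos_rem ((y + 2) * u) / u ^ 4 - 4 * (cos_rem ((y + 1) * u) / u ^ 4)
     + 6 * (cos_rem (y * u) / u ^ 4) - 4 * (cos_rem ((y - 1) * u) / u ^ 4)
     + cos_rem ((y - 2) * u) / u ^ 4) / 4"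
proof -
  have c2: "cos (2 * u) = 2 * (cos u)\<^sup>2 - 1" by (rule cos_double_cos)
  have "4 * ((1 - cos u)\<^sup>2 * cos (y * u)) = cos_rem ((y + 2) * u) - 4 * cos_rem ((y + 1) * u)
     + 6 * cos_rem (y * u) - 4 * cos_rem ((y - 1) * u) + cos_rem ((y - 2) * u)"
    unfolding cos_rem_def distrib_right left_diff_distrib cos_add cos_diff mult_1 c2
    by (simp add: power2_eq_square field_simps)
  from arg_cong[OF this, of "\<lambda>x. x / u ^ 4 / 4"] show ?thesis
    by (simp add: riesz_kernel_def add_divide_distrib diff_divide_distrib)
qed

text \<open>Up to a constant this is a cubic B-spline, which explains the compact support.\<close>

lemma riesz_mult_eq:
  "riesz_mult y = (LBINT u. cos_rem u / u ^ 4) / 4 *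
     (\<bar>y + 2\<bar> ^ 3 - 4 * \<bar>y + 1\<bar> ^ 3 + 6 * \<bar>y\<bar> ^ 3 - 4 * \<bar>y - 1\<bar> ^ 3 + \<bar>y - 2\<bar> ^ 3)"
  unfolding riesz_mult_def riesz_kernel_cos
  by (simp add: integrable_cos_rem_scaled integral_cos_rem_scaled del: times_divide_eq_right)
     (simp add: algebra_simps)

text \<open>All the absolute values open with the same sign, and the fourth difference of a cubic is
  0.\<close>

lemma riesz_mult_eq_0: "2 \<le> y \<Longrightarrow> riesz_mult y = 0"
  unfolding riesz_mult_eq by (simp add: eval_nat_numeral algebra_simps)

lemma riesz_mult_tendsto: "(\<lambda>k. riesz_mult (c / real (Suc k))) \<longlonglongrightarrow> riesz_mult 0"
proof -
  have "(\<lambda>k. c / real (Suc k)) \<longlonglongrightarrow> 0"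
    by (rule LIMSEQ_Suc) (rule lim_const_over_n)
  moreover have "isCont riesz_mult 0"
    unfolding riesz_mult_eq[abs_def] by (intro continuous_intros)
  ultimately show ?thesis by (rule isCont_tendsto_compose[rotated])
qed

lemma riesz_kernel_char:
  "(CLBINT u. of_real (riesz_kernel u) * exp (- (\<i> * of_real (y * u)))) = of_real (riesz_mult y)"
  and riesz_kernel_char_integrable:
  "complex_integrable lborel (\<lambda>u. of_real (riesz_kernel u) * exp (- (\<i> * of_real (y * u))))"
proof -
  let ?f = "\<lambda>u. of_real (riesz_kernel u) * exp (- (\<i> * of_real (y * u))) :: complex"
  let ?s = "\<lambda>u. riesz_kernel u * sin (y * u)" and ?c = "\<lambda>u. riesz_kernel u * cos (y * u)"
  have int: "integrable lborel ?s" "integrable lborel ?c"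
    by (rule Bochner_Integration.integrable_bound[OF integrable_riesz_kernel];
        simp add: abs_mult mult_left_le)+
  have eq: "?f = (\<lambda>u. of_real (?c u) - \<i> * of_real (?s u))"
    by (rule ext, rule complex_eqI) (simp_all add: exp_minus Re_exp Im_exp cis_conv_exp[symmetric] flip: exp_minus)
  show "complex_integrable lborel ?f"
    unfolding eq using int by (intro Bochner_Integration.integrable_diff integrable_mult_right integrable_of_real)
  \<comment> \<open>The kernel is even, so reflection maps the sine integral to its negative; only
    the cosine part survives.\<close>
  have "(LBINT u. ?s u) = \<bar>-1\<bar> *\<^sub>R (LBINT u. ?s (0 + (-1) * u))"
    by (rule lborel_integral_real_affine) simp
  also have "\<dots> = - (LBINT u. ?s u)" by (simp add: riesz_kernel_def)
  finally have "(LBINT u. ?s u) = 0" by simp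
  then show "(CLBINT u. ?f u) = of_real (riesz_mult y)"
    unfolding eq riesz_mult_def using int
    by (subst Bochner_Integration.integral_diff) (simp_all del: of_real_mult)
qed

section \<open>Bounds on a vertical line\<close>

text \<open>Averaging \<open>F (t + u / x)\<close> against the kernel multiplies the coefficient of
  index \<open>n\<close> by \<open>riesz_mult (lam n / x)\<close>, which is 0 once
  \<open>lam n\<close> reaches \<open>2 * x\<close>. The finite form of Kronecker's theorem applies
  to the remaining polynomial, and then \<open>x\<close> tends to infinity.\<close>

lemma kronecker_riesz_sum_norm_le:
  assumes ind: "rat_independent lam" and lam: "filterlim lam at_top sequentially"
    and F: "\<And>t. dir_term lam b (\<i> * of_real t) sums F t" and M: "\<And>t. norm (F t) \<le> M"
    and C: "\<And>N t. norm (dir_partial lam b N (\<i> * of_real t)) \<le> C * (1 + \<bar>t\<bar>)"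
  shows "(\<Sum>n<N. norm (b n)) \<le> M"
proof -
  have C0: "0 \<le> C" using order_trans[OF norm_ge_zero C[of 0 0]] by simp
  have key: "(\<Sum>n<N. norm (b n) * \<bar>riesz_mult (lam n / x)\<bar>) \<le> M * riesz_mult 0" if x: "x > 0" for x
  proof -
    have "eventually (\<lambda>n. 2 * x \<le> lam n) sequentially"
      using lam by (auto simp: filterlim_at_top)
    then obtain N0 where N0: "\<And>n. n \<ge> N0 \<Longrightarrow> 2 * x \<le> lam n"
      by (auto simp: eventually_sequentially)
    \<comment> \<open>Beyond \<open>N0\<close> the multiplier vanishes; taking at least
      \<open>N\<close> terms keeps the sum to be bounded inside.\<close>
    define K where "K = max N N0"
    define c where "c n = b n * of_real (riesz_mult (lam n / x))" for n
    have c0: "c n = 0" if "n \<ge> K" for n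
      using N0[of n] that x by (auto simp: c_def K_def riesz_mult_eq_0 pos_le_divide_eq)
    have "(\<Sum>n<K. norm (c n)) \<le> M * riesz_mult 0"
    proof (rule kronecker_sum_norm_le[OF ind])
      fix t :: real
      let ?S = "\<lambda>J u. dir_partial lam b J (\<i> * of_real (t + u / x)) * of_real (riesz_kernel u)"
      let ?G = "\<lambda>u. F (t + u / x) * of_real (riesz_kernel u)"
      let ?w = "\<lambda>u. (C * (1 + \<bar>t\<bar>) + C / x * \<bar>u\<bar>) * riesz_kernel u"
      have S_eq: "?S J = (\<lambda>u. \<Sum>n<J. dir_term lam b (\<i> * of_real t) n *
          (of_real (riesz_kernel u) * exp (- (\<i> * of_real (lam n / x * u)))))" for J
      proof (rule ext)
        fix u
        have "dir_term lam b (\<i> * of_real (t + u / x)) n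
            = dir_term lam b (\<i> * of_real t) n * exp (- (\<i> * of_real (lam n / x * u)))" for n
          by (simp add: dir_term_def distrib_left mult_ac flip: exp_add)
        then show "?S J u = (\<Sum>n<J. dir_term lam b (\<i> * of_real t) n *
          (of_real (riesz_kernel u) * exp (- (\<i> * of_real (lam n / x * u)))))"
          unfolding dir_partial_def sum_distrib_right by (intro sum.cong) (simp_all add: mult_ac)
      qed
      have S_int: "(CLBINT u. ?S J u) = dir_partial lam c J (\<i> * of_real t)" for J
      proof -
        have "(CLBINT u. ?S J u) = (\<Sum>n<J. dir_term lam b (\<i> * of_real t) n * of_real (riesz_mult (lam n / x)))"
          unfolding S_eq
          by (subst Bochner_Integration.integral_sum)
             (simp_all only: integrable_mult_right riesz_kernel_char_integrable integral_mult_right_zero riesz_kernel_char)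
        then show ?thesis by (simp add: dir_partial_def dir_term_def c_def mult_ac)
      qed
      have S_meas: "?S J \<in> borel_measurable lborel" for J
        unfolding S_eq by (intro borel_measurable_sum borel_measurable_times borel_measurable_const
            borel_measurable_integrable[OF riesz_kernel_char_integrable])
      have S_lim: "(\<lambda>J. ?S J u) \<longlonglongrightarrow> ?G u" for u
        using F[of "t + u / x"] unfolding sums_def dir_partial_def by (intro tendsto_mult tendsto_const)
      \<comment> \<open>Nothing is assumed about the measurability of \<open>F\<close>; it comes
        from the pointwise limit.\<close>
      have G_meas: "?G \<in> borel_measurable lborel"
        by (rule borel_measurable_LIMSEQ_metric[OF S_meas S_lim])
      have dom: "norm (?S J u) \<le> ?w u" for J u
      proof -
        have "norm (dir_partial lam b J (\<i> * of_real (t + u / x))) \<le> C * (1 + \<bar>t + u / x\<bar>)" by (rule C)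
        also have "\<dots> \<le> C * (1 + (\<bar>t\<bar> + \<bar>u / x\<bar>))" using C0 by (intro mult_left_mono add_left_mono abs_triangle_ineq)
        also have "\<dots> = C * (1 + \<bar>t\<bar>) + C / x * \<bar>u\<bar>" using x by (simp add: algebra_simps abs_divide)
        finally show ?thesis
          using riesz_kernel_nonneg[of u] by (simp only: norm_mult norm_of_real abs_of_nonneg mult_right_mono)
      qed
      have w_int: "integrable lborel ?w"
        by (rule integrable_riesz_kernel_linear) (use C0 x in auto)
      have conv: "(\<lambda>J. CLBINT u. ?S J u) \<longlonglongrightarrow> (CLBINT u. ?G u)"
        by (rule integral_dominated_convergence[where s = ?S, OF G_meas S_meas w_int]) (intro AE_I2 S_lim dom)+
      have G_int: "complex_integrable lborel ?G"
        by (rule integrable_dominated_convergence[where s = ?S, OF G_meas S_meas w_int]) (intro AE_I2 S_lim dom)+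
      \<comment> \<open>The integrals are constant from \<open>J = K\<close> on, so their limit is
        the Dirichlet polynomial itself.\<close>
      have "eventually (\<lambda>J. (CLBINT u. ?S J u) = dir_partial lam c K (\<i> * of_real t)) sequentially"
        using eventually_ge_at_top[of K]
      proof eventually_elim
        case (elim J)
        then show ?case unfolding S_int unfolding dir_partial_def
          by (intro sum.mono_neutral_right) (auto simp: dir_term_def c0)
      qed
      then have "(\<lambda>J. CLBINT u. ?S J u) \<longlonglongrightarrow> dir_partial lam c K (\<i> * of_real t)"
        by (rule tendsto_eventually)
      then have "dir_partial lam c K (\<i> * of_real t) = (CLBINT u. ?G u)"
        using conv by (rule LIMSEQ_unique)
      also have "norm \<dots> \<le> (LBINT u. M * riesz_kernel u)"
      proof (rule Bochner_Integration.integral_norm_bound_integral[OF G_int])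
        show "integrable lborel (\<lambda>u. M * riesz_kernel u)"
          using integrable_riesz_kernel by (rule integrable_mult_right)
        show "norm (?G u) \<le> M * riesz_kernel u" for u
          using riesz_kernel_nonneg[of u] M by (simp add: norm_mult mult_right_mono)
      qed
      also have "\<dots> = M * riesz_mult 0" by (simp add: riesz_mult_0)
      finally show "norm (dir_partial lam c K (\<i> * of_real t)) \<le> M * riesz_mult 0" .
    qed
    moreover have "(\<Sum>n<N. norm (c n)) \<le> (\<Sum>n<K. norm (c n))"
      by (intro sum_mono2) (auto simp: K_def)
    ultimately show ?thesis by (simp add: c_def norm_mult)
  qed
  \<comment> \<open>Scales \<open>x = Suc k\<close>, positive from the start, tend to infinity and
    drive every multiplier to the total mass.\<close>
  have "(\<lambda>k. \<Sum>n<N. norm (b n) * \<bar>riesz_mult (lam n / real (Suc k))\<bar>) \<longlonglongrightarrow> (\<Sum>n<N. norm (b n) * \<bar>riesz_mult 0\<bar>)"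
    by (intro tendsto_intros riesz_mult_tendsto)
  then have "(\<Sum>n<N. norm (b n) * \<bar>riesz_mult 0\<bar>) \<le> M * riesz_mult 0"
    by (rule LIMSEQ_le_const2) (use key in auto)
  then show ?thesis using riesz_mult_0_pos by (simp add: sum_distrib_right[symmetric])
qed

text \<open>Convergence at a single point to the left bounds the partial sums there. Abel summation
  then yields the linear growth on the line that the kernel argument tolerates.\<close>

lemma sum_norm_le_on_vertical_line:
  assumes freq: "frequency lam" and ind: "rat_independent lam"
    and s0: "summable (dir_term lam a s0)" "Re s0 < c"
    and F: "\<And>t. dir_term lam a (of_real c + \<i> * of_real t) sums F t" and M: "\<And>t. norm (F t) \<le> M"
  shows "(\<Sum>n<N. norm (a n) * exp (- lam n * c)) \<le> M"
proof -
  obtain B where B: "\<And>k. norm (\<Sum>n<k. dir_term lam a s0 n) \<le> B"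
    using convergent_imp_Bseq[OF s0(1)[unfolded summable_iff_convergent]] by (auto simp: Bseq_def)
  have B0: "B \<ge> 0" using B[of 0] by simp
  let ?d = "c - Re s0"
  \<comment> \<open>Chosen so that |z| \<le> |c - s0| + |t| \<le> (|c - s0| + 1)(1 + |t|) bounds the
    Abel factor by a multiple of 1 + |t|.\<close>
  define C where "C = B * (1 + (norm (of_real c - s0) + 1) / ?d)"
  have "(\<Sum>n<N. norm (dir_term lam a (of_real c) n)) \<le> M"
  proof (rule kronecker_riesz_sum_norm_le[OF ind])
    show "filterlim lam at_top sequentially" using freq by (simp add: frequency_def)
    show "dir_term lam (dir_term lam a (of_real c)) (\<i> * of_real t) sums F t" for t
      using F[of t] by (simp add: dir_term_add[abs_def])
    show "norm (F t) \<le> M" for t by (rule M)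
    fix N t
    let ?z = "of_real c + \<i> * of_real t - s0"
    have "dir_partial lam (dir_term lam a (of_real c)) N (\<i> * of_real t)
        = dir_partial lam (dir_term lam a s0) N ?z"
      unfolding dir_partial_def dir_term_add[symmetric] by simp
    also have "norm \<dots> \<le> B * (1 + norm ?z / Re ?z)"
      by (rule dir_partial_abel_bound)
         (use freq s0 B in \<open>auto simp: frequency_def strict_mono_mono\<close>)
    also have "norm ?z \<le> norm (of_real c - s0) + \<bar>t\<bar>"
      using norm_triangle_ineq[of "of_real c - s0" "\<i> * of_real t"] by (simp add: norm_mult algebra_simps)
    then have "B * (1 + norm ?z / Re ?z) \<le> B * (1 + (norm (of_real c - s0) + \<bar>t\<bar>) / ?d)"
      using B0 s0 by (intro mult_left_mono add_left_mono) (auto intro: divide_right_mono)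
    also have "\<dots> \<le> B * ((1 + (norm (of_real c - s0) + 1) / ?d) * (1 + \<bar>t\<bar>))"
    proof (intro mult_left_mono B0)
      have "norm (of_real c - s0) + \<bar>t\<bar> \<le> (norm (of_real c - s0) + 1) * (1 + \<bar>t\<bar>)"
        by (simp add: algebra_simps)
      then have "(norm (of_real c - s0) + \<bar>t\<bar>) / ?d \<le> (norm (of_real c - s0) + 1) * (1 + \<bar>t\<bar>) / ?d"
        using s0 by (intro divide_right_mono) auto
      then show "1 + (norm (of_real c - s0) + \<bar>t\<bar>) / ?d \<le> (1 + (norm (of_real c - s0) + 1) / ?d) * (1 + \<bar>t\<bar>)"
        by (simp add: distrib_right)
    qed
    finally show "norm (dir_partial lam (dir_term lam a (of_real c)) N (\<i> * of_real t)) \<le> C * (1 + \<bar>t\<bar>)"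
      by (simp add: C_def mult.assoc)
  qed
  then show ?thesis by (simp add: norm_dir_term)
qed

section \<open>Absolutely convergent Dirichlet series\<close>

lemma open_half_plane: "open (half_plane c)"
  by (simp add: half_plane_def open_halfspace_Re_gt)

lemma in_half_plane: "s \<in> half_plane c \<longleftrightarrow> c < Re s"
  by (simp add: half_plane_def)

lemma sums_dir_term:
  assumes lam: "\<forall>n. 0 \<le> lam n" and sm: "summable (\<lambda>n. norm (a n) * exp (- lam n * c))" and s: "c \<le> Re s"
  shows "summable (\<lambda>n. norm (dir_term lam a s n))" "dir_term lam a s sums (\<Sum>n. dir_term lam a s n)"
proof -
  show *: "summable (\<lambda>n. norm (dir_term lam a s n))"
    by (rule summable_comparison_test'[OF sm])
       (use lam s in \<open>auto simp: norm_dir_term intro!: mult_left_mono\<close>)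
  show "dir_term lam a s sums (\<Sum>n. dir_term lam a s n)"
    using summable_norm_cancel[OF *] by (rule summable_sums)
qed

lemma uniform_limit_dir_partial:
  assumes lam: "\<forall>n. 0 \<le> lam n" and sm: "summable (\<lambda>n. norm (a n) * exp (- lam n * c))"
  shows "uniform_limit (half_plane c) (dir_partial lam a) (\<lambda>s. \<Sum>n. dir_term lam a s n) sequentially"
  unfolding dir_partial_def[abs_def]
  by (rule Weierstrass_m_test[OF _ sm])
     (use lam in \<open>auto simp: norm_dir_term in_half_plane intro!: mult_left_mono\<close>)

lemma dir_partial_holomorphic: "dir_partial lam a N holomorphic_on S"
  unfolding dir_partial_def[abs_def] dir_term_def by (intro holomorphic_intros)

lemma dir_series_holomorphic:
  assumes lam: "\<forall>n. 0 \<le> lam n" and sm: "\<And>c. 0 < c \<Longrightarrow> summable (\<lambda>n. norm (a n) * exp (- lam n * c))"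
  shows "(\<lambda>s. \<Sum>n. dir_term lam a s n) holomorphic_on half_plane 0"
proof (rule holomorphic_uniform_sequence[OF open_half_plane dir_partial_holomorphic])
  fix s assume s: "s \<in> half_plane 0"
  \<comment> \<open>Halving the real part leaves room for a closed disc on which the convergence is
    uniform.\<close>
  then have s': "s \<in> half_plane (Re s / 2)" "0 < Re s / 2" by (auto simp: in_half_plane)
  then obtain d where d: "0 < d" "cball s d \<subseteq> half_plane (Re s / 2)"
    using open_half_plane open_contains_cball by meson
  moreover have "half_plane (Re s / 2) \<subseteq> half_plane 0" using s by (auto simp: in_half_plane)
  moreover have "uniform_limit (cball s d) (dir_partial lam a) (\<lambda>s. \<Sum>n. dir_term lam a s n) sequentially"
    by (rule uniform_limit_on_subset[OF uniform_limit_dir_partial[OF lam sm[OF s'(2)]] d(2)])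
  ultimately show "\<exists>d. 0 < d \<and> cball s d \<subseteq> half_plane 0 \<and>
      uniform_limit (cball s d) (dir_partial lam a) (\<lambda>s. \<Sum>n. dir_term lam a s n) sequentially"
    by blast
qed

section \<open>Landau's theorem\<close>

lemma higher_deriv_dir_partial:
  "(deriv ^^ k) (dir_partial lam a N) = dir_partial lam (\<lambda>n. a n * of_real (- lam n) ^ k) N"
proof (induction k arbitrary: a)
  case (Suc k)
  have "deriv (dir_partial lam a N) = dir_partial lam (\<lambda>n. a n * of_real (- lam n)) N"
    unfolding dir_partial_def[abs_def] dir_term_def
    by (intro ext DERIV_imp_deriv) (auto intro!: derivative_eq_intros sum.cong)
  then show ?case
    by (simp add: funpow_Suc_right Suc.IH mult_ac del: funpow.simps)
qed simp

text \<open>\<open>x ^ k / fact k\<close> is one of the nonnegative terms of the exponential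
  series.\<close>

lemma power_le_fact_exp: "0 \<le> x \<Longrightarrow> x ^ k \<le> fact k * exp x" for x :: real
proof -
  assume x: "0 \<le> x"
  have "(\<Sum>n\<in>{k}. x ^ n /\<^sub>R fact n) \<le> (\<Sum>n. x ^ n /\<^sub>R fact n)"
    by (rule sum_le_suminf[OF summable_exp_generic]) (use x in auto)
  then show ?thesis by (simp add: exp_def field_simps)
qed

lemma summable_norm_dir_term_extend:
  assumes lam: "\<forall>n. 0 \<le> lam n" and ind: "rat_independent lam"
    and hol: "f holomorphic_on half_plane 0" and M: "\<And>s. s \<in> half_plane 0 \<Longrightarrow> norm (f s) \<le> M"
    and c: "0 \<le> c" and sm: "summable (\<lambda>n. norm (a n) * exp (- lam n * c))"
    and f: "\<And>s. s \<in> half_plane c \<Longrightarrow> dir_term lam a s sums f s" and x: "0 < x"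
  shows "summable (\<lambda>n. norm (a n) * exp (- lam n * x))"
proof -
  \<comment> \<open>\<open>c1\<close> is the abscissa of the centres, more than \<open>x\<close> and
    at least 1 beyond \<open>c\<close>. Discs of radius \<open>r\<close> stay at distance
    \<open>x / 2\<close> from the imaginary axis, and the shift \<open>y\<close> from
    \<open>c1\<close> down to \<open>x\<close> is less than \<open>r\<close>.\<close>
  define c1 where "c1 = max c x + 1"
  define r where "r = c1 - x / 2"
  define y where "y = c1 - x"
  have ord: "c + 1 \<le> c1" "0 < y" "y < r" "0 < r" "r < c1" using x c by (auto simp: c1_def r_def y_def)
  have M0: "0 \<le> M" using order_trans[OF norm_ge_zero M[of 1]] by (simp add: in_half_plane)
  have deriv_sums: "dir_term lam (\<lambda>n. a n * of_real (- lam n) ^ k) s sums (deriv ^^ k) f s"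
    if s: "s \<in> half_plane c" for s k
  proof -
    have "uniform_limit (half_plane c) (dir_partial lam a) f sequentially"
      using uniform_limit_dir_partial[OF lam sm] by (rule uniform_limit_cong'[THEN iffD1, rotated 2])
        (use f in \<open>auto simp: sums_iff\<close>)
    from higher_deriv_complex_uniform_limit[OF this _ _ open_half_plane s, of k]
    show ?thesis
      by (simp add: dir_partial_holomorphic higher_deriv_dir_partial) (simp add: sums_def dir_partial_def)
  qed
  have cauchy: "norm ((deriv ^^ k) f (of_real c1 + \<i> * of_real t)) \<le> fact k * M / r ^ k" for k t
  proof (rule Cauchy_inequality)
    let ?z = "of_real c1 + \<i> * of_real t"
    have sub: "cball ?z r \<subseteq> half_plane 0"
    proof
      fix w assume "w \<in> cball ?z r"
      then have "\<bar>Re (?z - w)\<bar> \<le> r" using abs_Re_le_cmod[of "?z - w"] by (simp add: dist_norm)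
      then show "w \<in> half_plane 0" using ord by (simp add: in_half_plane)
    qed
    then show "f holomorphic_on ball ?z r" "continuous_on (cball ?z r) f"
      using hol holomorphic_on_subset holomorphic_on_imp_continuous_on ball_subset_cball by (blast, blast)
    show "norm (f w) \<le> M" if "norm (?z - w) = r" for w
      using that sub by (intro M) (auto simp: dist_norm)
  qed (use ord in auto)
  have coeff: "(\<Sum>n<N. norm (a n) * lam n ^ k * exp (- lam n * c1)) \<le> fact k * M / r ^ k" for N k
  proof -
    let ?b = "dir_term lam (\<lambda>n. a n * of_real (- lam n) ^ k) (of_real c1)"
    have nb: "norm (?b n) = norm (a n) * lam n ^ k * exp (- lam n * c1)" for n
      using lam[rule_format, of n] by (simp add: norm_dir_term norm_mult norm_power)
    have sb: "summable (\<lambda>n. norm (?b n))"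
    proof (rule summable_comparison_test'[OF summable_mult[OF sm, of "fact k"]])
      fix n
      have "lam n ^ k * exp (- lam n * c1) \<le> (fact k * exp (lam n)) * exp (- lam n * (c + 1))"
        using lam[rule_format, of n] ord by (intro mult_mono power_le_fact_exp) (auto intro: mult_left_mono)
      also have "\<dots> = fact k * exp (- lam n * c)"
        by (simp add: mult.assoc algebra_simps flip: exp_add)
      finally have "norm (a n) * (lam n ^ k * exp (- lam n * c1)) \<le> norm (a n) * (fact k * exp (- lam n * c))"
        by (intro mult_left_mono) auto
      then show "norm (norm (?b n)) \<le> fact k * (norm (a n) * exp (- lam n * c))"
        unfolding nb using lam[rule_format, of n] by (simp add: abs_mult mult_ac)
    qed
    have le: "(\<Sum>n. norm (?b n)) \<le> fact k * M / r ^ k"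
    proof (rule kronecker_suminf_norm_le[OF ind sb])
      fix t
      have "dir_term lam ?b (\<i> * of_real t) sums (deriv ^^ k) f (of_real c1 + \<i> * of_real t)"
        using deriv_sums[of "of_real c1 + \<i> * of_real t" k] ord
        by (simp add: in_half_plane dir_term_add[abs_def])
      then show "norm (\<Sum>n. dir_term lam ?b (\<i> * of_real t) n) \<le> fact k * M / r ^ k"
        using cauchy[of k t] by (simp add: sums_unique[symmetric])
    qed
    show ?thesis using order_trans[OF sum_le_suminf[OF sb finite_lessThan norm_ge_zero] le] unfolding nb .
  qed
  have bound: "(\<Sum>n<N. norm (a n) * exp (- lam n * x)) \<le> M / (1 - y / r)" for N
  proof -
    have "(\<lambda>k. \<Sum>n<N. norm (a n) * exp (- lam n * c1) * ((lam n * y) ^ k /\<^sub>R fact k))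
        sums (\<Sum>n<N. norm (a n) * exp (- lam n * c1) * exp (lam n * y))"
      by (intro sums_sum sums_mult exp_converges)
    also have "(\<Sum>n<N. norm (a n) * exp (- lam n * c1) * exp (lam n * y))
        = (\<Sum>n<N. norm (a n) * exp (- lam n * x))"
      by (intro sum.cong refl) (simp add: y_def mult.assoc algebra_simps flip: exp_add)
    finally have 1: "(\<lambda>k. \<Sum>n<N. norm (a n) * exp (- lam n * c1) * ((lam n * y) ^ k /\<^sub>R fact k))
        sums (\<Sum>n<N. norm (a n) * exp (- lam n * x))" .
    have 2: "(\<lambda>k. M * (y / r) ^ k) sums (M * (1 / (1 - y / r)))"
      by (intro sums_mult geometric_sums) (use ord in auto)
    have "(\<Sum>n<N. norm (a n) * exp (- lam n * x)) \<le> M * (1 / (1 - y / r))"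
    proof (rule sums_le[OF _ 1 2])
      fix k
      have "(\<Sum>n<N. norm (a n) * exp (- lam n * c1) * ((lam n * y) ^ k /\<^sub>R fact k))
          = y ^ k / fact k * (\<Sum>n<N. norm (a n) * lam n ^ k * exp (- lam n * c1))"
        unfolding sum_distrib_left by (intro sum.cong) (auto simp: power_mult_distrib field_simps)
      also have "\<dots> \<le> y ^ k / fact k * (fact k * M / r ^ k)"
        by (intro mult_left_mono coeff) (use ord in auto)
      also have "\<dots> = M * (y / r) ^ k" by (simp add: power_divide)
      finally show "(\<Sum>n<N. norm (a n) * exp (- lam n * c1) * ((lam n * y) ^ k /\<^sub>R fact k)) \<le> M * (y / r) ^ k" .
    qed
    then show ?thesis by simp
  qed
  show ?thesis by (rule summableI_nonneg_bounded[OF _ bound]) auto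
qed

section \<open>The coefficient spaces\<close>

lemma ell1_limit:
  assumes "\<And>x N. 0 < x \<Longrightarrow> (\<Sum>n<N. norm (a n) * exp (- lam n * x)) \<le> M"
  shows "a \<in> ell1" "ell1_norm a \<le> M"
proof -
  have *: "(\<Sum>n<N. norm (a n)) \<le> M" for N
  proof -
    have "((\<lambda>x. \<Sum>n<N. norm (a n) * exp (- lam n * x)) \<longlongrightarrow> (\<Sum>n<N. norm (a n) * exp (- lam n * 0))) (at_right 0)"
      by (intro tendsto_intros)
    then have "(\<Sum>n<N. norm (a n) * exp (- lam n * 0)) \<le> M"
      by (rule tendsto_upperbound) (use assms in \<open>auto intro!: eventually_at_rightI[of 0 1]\<close>)
    then show ?thesis by simp
  qed
  have "summable (\<lambda>n. norm (a n))" by (rule summableI_nonneg_bounded[OF _ *]) auto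
  then show "a \<in> ell1" "ell1_norm a \<le> M"
    using * by (auto simp: ell1_def ell1_norm_def intro: suminf_le_const)
qed

lemma ell1_dir_term:
  assumes lam: "\<forall>n. 0 \<le> lam n" and a: "a \<in> ell1" and s: "0 \<le> Re s"
  shows "dir_term lam a s sums (\<Sum>n. dir_term lam a s n)"
    "norm (\<Sum>n. dir_term lam a s n) \<le> ell1_norm a" "norm (dir_partial lam a N s) \<le> ell1_norm a"
proof -
  have sm: "summable (\<lambda>n. norm (a n))" using a by (simp add: ell1_def)
  have sm0: "summable (\<lambda>n. norm (a n) * exp (- lam n * 0))" using sm by simp
  show "dir_term lam a s sums (\<Sum>n. dir_term lam a s n)" by (rule sums_dir_term[OF lam sm0 s])
  have le: "norm (dir_term lam a s n) \<le> norm (a n)" for n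
    using lam[rule_format, of n] s by (auto simp: norm_dir_term intro!: mult_left_le)
  show "norm (\<Sum>n. dir_term lam a s n) \<le> ell1_norm a"
    using summable_norm[OF sums_dir_term(1)[OF lam sm0 s]]
      suminf_le[OF le sums_dir_term(1)[OF lam sm0 s] sm] by (simp add: ell1_norm_def)
  have "norm (dir_partial lam a N s) \<le> (\<Sum>n<N. norm (a n))"
    unfolding dir_partial_def by (intro sum_norm_le le)
  also have "\<dots> \<le> ell1_norm a" unfolding ell1_norm_def by (intro sum_le_suminf sm) auto
  finally show "norm (dir_partial lam a N s) \<le> ell1_norm a" .
qed

lemma ell1_summable_exp:
  assumes lam: "\<forall>n. 0 \<le> lam n" and a: "a \<in> ell1" and c: "0 \<le> c"
  shows "summable (\<lambda>n. norm (a n) * exp (- lam n * c))"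
  using sums_dir_term(1)[OF lam, of a 0 "of_real c"] a c by (simp add: ell1_def norm_dir_term)

lemma ell1_bounded_extension:
  assumes lam: "\<forall>n. 0 \<le> lam n" and a: "a \<in> ell1"
  shows "bounded_extension lam a (\<lambda>s. \<Sum>n. dir_term lam a s n)"
  unfolding bounded_extension_def
proof (intro conjI exI[of _ 0] ballI)
  show "(\<lambda>s. \<Sum>n. dir_term lam a s n) holomorphic_on half_plane 0"
    by (rule dir_series_holomorphic[OF lam ell1_summable_exp[OF lam a]]) auto
  show "bounded ((\<lambda>s. \<Sum>n. dir_term lam a s n) ` half_plane 0)"
    using ell1_dir_term(2)[OF lam a] by (auto simp: bounded_iff in_half_plane intro!: exI[of _ "ell1_norm a"])
  show "dir_term lam a s sums (\<Sum>n. dir_term lam a s n)" if "s \<in> half_plane 0" for s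
    using that by (intro ell1_dir_term[OF lam a]) (simp add: in_half_plane)
qed auto

lemma ell1_norm_le_of_abs_convergent:
  assumes lam: "\<forall>n. 0 \<le> lam n" and ind: "rat_independent lam"
    and sm: "\<And>x. 0 < x \<Longrightarrow> summable (\<lambda>n. norm (a n) * exp (- lam n * x))"
    and M: "\<And>s. s \<in> half_plane 0 \<Longrightarrow> norm (\<Sum>n. dir_term lam a s n) \<le> M"
  shows "a \<in> ell1" "ell1_norm a \<le> M"
proof -
  have bnd: "(\<Sum>n<N. norm (a n) * exp (- lam n * x)) \<le> M" if x: "0 < x" for x N
  proof -
    let ?b = "dir_term lam a (of_real x)"
    have nb: "norm (?b n) = norm (a n) * exp (- lam n * x)" for n by (simp add: norm_dir_term)
    have sb: "summable (\<lambda>n. norm (?b n))" using sm[OF x] by (simp only: nb)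
    have "(\<Sum>n. norm (?b n)) \<le> M"
    proof (rule kronecker_suminf_norm_le[OF ind sb])
      show "norm (\<Sum>n. dir_term lam ?b (\<i> * of_real t) n) \<le> M" for t
        using M[of "of_real x + \<i> * of_real t"] x by (simp add: in_half_plane dir_term_add)
    qed
    then show ?thesis using sum_le_suminf[OF sb, of "{..<N}"] by (simp add: nb)
  qed
  show "a \<in> ell1" by (rule ell1_limit(1)[OF bnd])
  show "ell1_norm a \<le> M" by (rule ell1_limit(2)[OF bnd])
qed

lemma D_norm_eq_ell1_norm:
  assumes lam: "\<forall>n. 0 \<le> lam n" and ind: "rat_independent lam" and a: "a \<in> ell1"
  shows "D_norm lam a = ell1_norm a"
proof -
  let ?f = "\<lambda>s. \<Sum>n. dir_term lam a s n"
  have le: "norm (?f s) \<le> ell1_norm a" if "s \<in> half_plane 0" for s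
    using that by (intro ell1_dir_term[OF lam a]) (simp add: in_half_plane)
  have "(1::complex) \<in> half_plane 0" by (simp add: in_half_plane)
  then have "(SUP s\<in>half_plane 0. norm (?f s)) \<le> ell1_norm a"
    by (intro cSUP_least le) auto
  moreover have "ell1_norm a \<le> (SUP s\<in>half_plane 0. norm (?f s))"
  proof (rule ell1_norm_le_of_abs_convergent(2)[OF lam ind])
    show "norm (?f s) \<le> (SUP s\<in>half_plane 0. norm (?f s))" if "s \<in> half_plane 0" for s
      using le that by (intro cSUP_upper) (auto simp: bdd_above_def)
  qed (use ell1_summable_exp[OF lam a] in auto)
  ultimately show ?thesis
    using D_norm_eq[OF ell1_bounded_extension[OF lam a]] by simp
qed

lemma D_ext_subset_ell1:
  assumes freq: "frequency lam" and ind: "rat_independent lam"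
  shows "D_ext lam \<subseteq> ell1"
proof
  fix a assume "a \<in> D_ext lam"
  then obtain f where "bounded_extension lam a f" by (auto simp: D_ext_def)
  then obtain \<sigma> M where hol: "f holomorphic_on half_plane 0" and \<sigma>: "0 \<le> \<sigma>"
    and f: "\<And>s. s \<in> half_plane \<sigma> \<Longrightarrow> dir_term lam a s sums f s"
    and M: "\<And>s. s \<in> half_plane 0 \<Longrightarrow> norm (f s) \<le> M"
    by (auto simp: bounded_extension_def bounded_iff)
  have lam: "\<forall>n. 0 \<le> lam n" using freq by (simp add: frequency_def)
  define c where "c = \<sigma> + 1"
  have "(\<Sum>n<N. norm (a n) * exp (- lam n * c)) \<le> M" for N
  proof (rule sum_norm_le_on_vertical_line[OF freq ind])
    show "summable (dir_term lam a (of_real (\<sigma> + 1/2)))"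
      by (rule sums_summable[OF f]) (simp add: in_half_plane)
    show "dir_term lam a (of_real c + \<i> * of_real t) sums f (of_real c + \<i> * of_real t)" for t
      by (rule f) (simp add: in_half_plane c_def)
    show "norm (f (of_real c + \<i> * of_real t)) \<le> M" for t
      by (rule M) (use \<sigma> in \<open>simp add: in_half_plane c_def\<close>)
  qed (simp add: c_def)
  then have smc: "summable (\<lambda>n. norm (a n) * exp (- lam n * c))"
    by (intro summableI_nonneg_bounded) auto
  have fc: "dir_term lam a s sums f s" if "s \<in> half_plane c" for s
    by (rule f) (use that in \<open>simp add: in_half_plane c_def\<close>)
  have c0: "0 \<le> c" using \<sigma> by (simp add: c_def)
  note sm = summable_norm_dir_term_extend[OF lam ind hol M c0 smc fc]
  have eq: "f s = (\<Sum>n. dir_term lam a s n)" if s: "s \<in> half_plane 0" for s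
  proof (rule analytic_continuation_open[OF open_half_plane open_half_plane _ _ _ hol _ _ s])
    have "of_real (c + 1) \<in> half_plane c" by (simp add: in_half_plane)
    then show "half_plane c \<noteq> {}" by blast
    show "connected (half_plane 0)"
      unfolding half_plane_def by (intro convex_connected convex_halfspace_Re_gt)
    show "half_plane c \<subseteq> half_plane 0" using c0 by (auto simp: in_half_plane)
    show "(\<lambda>s. \<Sum>n. dir_term lam a s n) holomorphic_on half_plane 0"
      by (rule dir_series_holomorphic[OF lam sm])
    show "f z = (\<Sum>n. dir_term lam a z n)" if "z \<in> half_plane c" for z
      using fc[OF that] by (rule sums_unique)
  qed
  show "a \<in> ell1"
    by (rule ell1_norm_le_of_abs_convergent(1)[OF lam ind sm, where M = M]) (use M eq in auto)
qed

lemma D_inf_subset_ell1: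
  assumes freq: "frequency lam" and ind: "rat_independent lam"
  shows "D_inf lam \<subseteq> ell1"
proof
  fix a assume "a \<in> D_inf lam"
  then obtain M where sm: "\<And>s. s \<in> half_plane 0 \<Longrightarrow> summable (dir_term lam a s)"
    and M: "\<And>s. s \<in> half_plane 0 \<Longrightarrow> norm (\<Sum>n. dir_term lam a s n) \<le> M"
    by (auto simp: D_inf_def bounded_iff)
  have "(\<Sum>n<N. norm (a n) * exp (- lam n * x)) \<le> M" if x: "0 < x" for x N
  proof (rule sum_norm_le_on_vertical_line[OF freq ind])
    show "summable (dir_term lam a (of_real (x / 2)))"
      by (rule sm) (use x in \<open>simp add: in_half_plane\<close>)
    show "dir_term lam a (of_real x + \<i> * of_real t) sums (\<Sum>n. dir_term lam a (of_real x + \<i> * of_real t) n)" for t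
      by (rule summable_sums[OF sm]) (use x in \<open>simp add: in_half_plane\<close>)
    show "norm (\<Sum>n. dir_term lam a (of_real x + \<i> * of_real t) n) \<le> M" for t
      by (rule M) (use x in \<open>simp add: in_half_plane\<close>)
  qed (use x in simp)
  then show "a \<in> ell1" by (rule ell1_limit)
qed

lemma ell1_subset_D_spaces:
  assumes lam: "\<forall>n. 0 \<le> lam n"
  shows "ell1 \<subseteq> D_ext lam" "ell1 \<subseteq> D_inf lam"
proof -
  show "ell1 \<subseteq> D_ext lam"
  proof
    fix a assume a: "a \<in> ell1"
    then have "summable (dir_term lam a 0)"
      using ell1_dir_term(1)[OF lam a, of 0] by (simp add: sums_summable)
    with ell1_bounded_extension[OF lam a] show "a \<in> D_ext lam" by (auto simp: D_ext_def)
  qed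
  show "ell1 \<subseteq> D_inf lam"
  proof
    fix a assume a: "a \<in> ell1"
    from ell1_bounded_extension[OF lam a] have "bounded ((\<lambda>s. \<Sum>n. dir_term lam a s n) ` half_plane 0)"
      by (simp add: bounded_extension_def)
    moreover have "summable (dir_term lam a s)" if "s \<in> half_plane 0" for s
      using ell1_dir_term(1)[OF lam a, of s] that by (simp add: sums_summable in_half_plane)
    ultimately show "a \<in> D_inf lam" by (simp add: D_inf_def)
  qed
qed

lemma SUP_dir_partial_eq_D_norm:
  assumes lam: "\<forall>n. 0 \<le> lam n" and ind: "rat_independent lam" and a: "a \<in> ell1"
  shows "(SUP N\<in>{1..}. SUP s\<in>half_plane 0. ereal (norm (dir_partial lam a N s))) = ereal (D_norm lam a)"
    (is "?L = _")
proof (rule antisym)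
  show "?L \<le> ereal (D_norm lam a)"
    unfolding D_norm_eq_ell1_norm[OF lam ind a]
    by (intro SUP_least) (use ell1_dir_term(3)[OF lam a] in \<open>simp add: in_half_plane\<close>)
  have ge: "ereal (norm (\<Sum>n. dir_term lam a s n)) \<le> ?L" if s: "s \<in> half_plane 0" for s
  proof (rule LIMSEQ_le_const2)
    have "(\<lambda>N. dir_partial lam a N s) \<longlonglongrightarrow> (\<Sum>n. dir_term lam a s n)"
      using ell1_dir_term(1)[OF lam a, of s] s by (simp add: sums_def dir_partial_def in_half_plane)
    then show "(\<lambda>N. ereal (norm (dir_partial lam a N s))) \<longlonglongrightarrow> ereal (norm (\<Sum>n. dir_term lam a s n))"
      by (intro tendsto_intros)
    show "\<exists>N0. \<forall>N\<ge>N0. ereal (norm (dir_partial lam a N s)) \<le> ?L"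
    proof (intro exI[of _ 1] allI impI)
      fix N :: nat assume "1 \<le> N"
      then show "ereal (norm (dir_partial lam a N s)) \<le> ?L"
        using s by (intro SUP_upper2[of N] SUP_upper2[of s]) auto
    qed
  qed
  have one: "(1::complex) \<in> half_plane 0" by (simp add: in_half_plane)
  show "ereal (D_norm lam a) \<le> ?L"
  proof (cases ?L)
    case (real l)
    have "(SUP s\<in>half_plane 0. norm (\<Sum>n. dir_term lam a s n)) \<le> l"
      by (rule cSUP_least) (use ge one real in auto)
    then show ?thesis
      unfolding real D_norm_eq[OF ell1_bounded_extension[OF lam a]] by simp
  next
    case MInf
    then show ?thesis using ge[OF one] by simp
  qed simp
qed

lemma ell1_bohr:
  assumes lam: "\<forall>n. 0 \<le> lam n" and a: "a \<in> ell1" and \<epsilon>: "0 < \<epsilon>"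
  shows "uniformly_convergent_on (half_plane \<epsilon>) (dir_partial lam a)"
  unfolding uniformly_convergent_on_def
  by (rule exI) (rule uniform_limit_dir_partial[OF lam ell1_summable_exp[OF lam a less_imp_le[OF \<epsilon>]]])

theorem theorem4p7:
  fixes lam :: "nat \<Rightarrow> real"
  assumes "frequency lam"
    and "rat_independent lam"
  shows "(\<forall>a\<in>D_ext lam. a \<in> ell1 \<and> ell1_norm a = D_norm lam a) \<and>
         D_ext lam = D_inf lam \<and> D_inf lam = ell1 \<and>
         (\<forall>a\<in>ell1. D_norm lam a = ell1_norm a) \<and>
         bohr_theorem lam \<and>
         (\<forall>a\<in>D_ext lam.
            (SUP N\<in>{1..}. SUP s\<in>half_plane 0. ereal (norm (dir_partial lam a N s)))
              = ereal (D_norm lam a))"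
proof -
  have lam: "\<forall>n. 0 \<le> lam n" using assms(1) by (simp add: frequency_def)
  have "D_ext lam = ell1" "D_inf lam = ell1"
    using D_ext_subset_ell1[OF assms] D_inf_subset_ell1[OF assms] ell1_subset_D_spaces[OF lam] by auto
  then show ?thesis
    using D_norm_eq_ell1_norm[OF lam assms(2)] SUP_dir_partial_eq_D_norm[OF lam assms(2)] ell1_bohr[OF lam]
    by (simp add: bohr_theorem_def)
qed

end
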